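(* Let $(X^*,z^* )$ be a minimizer of $$\min_{X\in\mathbb{R}^{N\times N},\ z\in\mathcal{Z}}\ \operatorname{Tr}(\tilde W X)\quad\text{subject to}\quad \tilde L(z)X=I_N$$ with budget $K=N$ (radial network). Suppose a critical edge $\ell=(i,j)\in\hat{\mathcal{E}}$ partitions the nodes of $\hat{\mathcal{G}}$ into two disjoint connected components $\mathcal{V}_\ell$ and its complement $\bar{\mathcal{V}}_\ell=\mathcal{V}\setminus\mathcal{V}_\ell$. If $\mathcal{V}_\ell$ contains node $i$ as well as the reference node $0$, then $$h_j\le X^*_{kj}\qquad\text{for all } k\in\bar{\mathcal{V}}_\ell.$$
   Context: Let $\hat{\mathcal{G}}=(\mathcal{V},\hat{\mathcal{E}})$ be an undirected graph with nodes $\mathcal{V}=\{0,1,\dots,N\}$ and candidate lines (edges) $\hat{\mathcal{E}}$; each line $(i,j)\in\hat{\mathcal{E}}$ has susceptance $b_{ij}>0$. Node $0$ is the reference node and $\mathcal{V}_r=\mathcal{V}\setminus\{0\}=\{1,\dots,N\}$. For each line $(i,j)$ (with an arbitrary fixed orientation), $a_{ij}\in\mathbb{R}^N$ is the vector indexed by $\mathcal{V}_r$ with $n$-th entry $+1$ if $n=i$, $-1$ if $n=j$, and $0$ otherwise. For the budget $K$, $\mathcal{Z}=\{z\in\{0,1\}^{|\hat{\mathcal{E}}|}:\ \sum_{m\in\hat{\mathcal{E}}}z_m\le K\}$; here $K=N$. For $z\in\mathcal{Z}$, $\tilde L(z)=\sum_{(i,j)\in\hat{\mathcal{E}}}z_{ij}b_{ij}a_{ij}a_{ij}^\top\in\mathbb{R}^{N\times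 N}$ is the reduced susceptance Laplacian of the graph formed by the selected lines. $W$ is the Laplacian matrix of a connected graph on $\mathcal{V}$ with non-negative edge weights, and $\tilde W\in\mathbb{R}^{N\times N}$ is obtained from $W$ by deleting the row and column of the reference node $0$. Let $\mathcal{G}_r$ be the graph with the same nodes and edges as $\hat{\mathcal{G}}$ but with edge weights equal to the inverse susceptances $x_{ij}=b_{ij}^{-1}$; for $i\in\mathcal{V}_r$, $h_i$ is the sum of edge weights along a shortest (minimum-weight) path from $i$ to node $0$ in $\mathcal{G}_r$. A (single) critical edge is an edge $\ell\in\hat{\mathcal{E}}$ whose removal disconnects $\hat{\mathcal{G}}$; the components $\mathcal{V}_\ell$ and $\bar{\mathcal{V}}_\ell$ are the node sets of the two connected components of $\hat{\mathcal{G}}$ after removing $\ell$. *)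

theory Defs
  imports "HOL-Analysis.Analysis"
begin

text \<open>
  A graph on the node set \<^typ>\<open>'v\<close> is given by its set of edges, each edge being an
  unordered pair of distinct nodes. Edge data (weights, susceptances, selection variables)
  are functions on edges.
\<close>

type_synonym 'v edge = "'v set"

definition simple_graph :: "'v edge set \<Rightarrow> bool" where
  "simple_graph E \<longleftrightarrow> (\<forall>e\<in>E. card e = 2)"

definition reachable :: "'v edge set \<Rightarrow> ('v \<times> 'v) set" where
  "reachable E = {(u, v). {u, v} \<in> E}\<^sup>*"

definition connected_graph :: "'v edge set \<Rightarrow> bool" where
  "connected_graph E \<longleftrightarrow> (\<forall>u v. (u, v) \<in> reachable E)"

definition graph_components :: "'v edge set \<Rightarrow> 'v set set" where
  "graph_components E = UNIV // reachable E"

definition critical_edge :: "'v edge set \<Rightarrow> 'v edge \<Rightarrow> bool" where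
  "critical_edge E l \<longleftrightarrow> l \<in> E \<and> connected_graph E \<and> \<not> connected_graph (E - {l})"

definition is_path :: "'v edge set \<Rightarrow> 'v \<Rightarrow> 'v \<Rightarrow> 'v list \<Rightarrow> bool" where
  "is_path E u v p \<longleftrightarrow>
     p \<noteq> [] \<and> hd p = u \<and> last p = v \<and> distinct p \<and> successively (\<lambda>s t. {s, t} \<in> E) p"

definition path_weight :: "('v edge \<Rightarrow> real) \<Rightarrow> 'v list \<Rightarrow> real" where
  "path_weight x p = (\<Sum>m<length p - 1. x {p ! m, p ! Suc m})"

text \<open>
  The minimum ranges over a finite set, since paths do not repeat nodes and \<^typ>\<open>'v\<close> is
  finite. The value is unspecified if the two nodes are not connected.
\<close>

definition shortest_path_weight :: "'v::finite edge set \<Rightarrow> ('v edge \<Rightarrow> real) \<Rightarrow> 'v \<Rightarrow> 'v \<Rightarrow> real" where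
  "shortest_path_weight E x u v = Min (path_weight x ` {p. is_path E u v p})"

definition laplacian :: "'v::finite edge set \<Rightarrow> ('v edge \<Rightarrow> real) \<Rightarrow> real^'v^'v" where
  "laplacian F w = (\<chi> u v. if u = v then (\<Sum>e | e \<in> F \<and> u \<in> e. w e)
                           else if {u, v} \<in> F then - w {u, v} else 0)"

text \<open>
  In a network with \<open>N = CARD('n)\<close> non-reference nodes the nodes form the type
  \<^typ>\<open>'n option\<close>: \<open>None\<close> is the reference node 0 and the nodes \<open>Some n\<close> make up
  \<open>V\<^sub>r = {1, \<dots>, N}\<close>. Vectors and matrices indexed by \<open>V\<^sub>r\<close> are indexed by \<^typ>\<open>'n\<close>.
\<close>

definition reduced_matrix :: "real^('n::finite option)^('n option) \<Rightarrow> real^'n^'n" where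
  "reduced_matrix W = (\<chi> m n. W $ Some m $ Some n)"

definition incidence_vector :: "'n option \<Rightarrow> 'n option \<Rightarrow> real^'n::finite" where
  "incidence_vector i j = (\<chi> n. if Some n = i then 1 else if Some n = j then -1 else 0)"

text \<open>The functions \<open>src\<close> and \<open>tgt\<close> orient every edge \<open>e = {src e, tgt e}\<close>.\<close>

definition reduced_susceptance_laplacian ::
  "'n::finite option edge set \<Rightarrow> ('n option edge \<Rightarrow> 'n option) \<Rightarrow> ('n option edge \<Rightarrow> 'n option)
    \<Rightarrow> ('n option edge \<Rightarrow> real) \<Rightarrow> ('n option edge \<Rightarrow> real) \<Rightarrow> real^'n^'n" where
  "reduced_susceptance_laplacian E src tgt b z =
     (\<Sum>e\<in>E. let a = incidence_vector (src e) (tgt e) in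
        (z e * b e) *\<^sub>R (columnvector a ** (rowvector a :: real^'n^1)))"

definition selections :: "'v edge set \<Rightarrow> nat \<Rightarrow> ('v edge \<Rightarrow> real) set" where
  "selections E K = {z \<in> E \<rightarrow>\<^sub>E {0, 1}. (\<Sum>e\<in>E. z e) \<le> real K}"

definition design_minimizer ::
  "'n::finite option edge set \<Rightarrow> ('n option edge \<Rightarrow> 'n option) \<Rightarrow> ('n option edge \<Rightarrow> 'n option)
    \<Rightarrow> ('n option edge \<Rightarrow> real) \<Rightarrow> real^('n option)^('n option) \<Rightarrow> nat
    \<Rightarrow> real^'n^'n \<Rightarrow> ('n option edge \<Rightarrow> real) \<Rightarrow> bool" where
  "design_minimizer E src tgt b W K X z \<longleftrightarrow>
     is_arg_min (\<lambda>(X, z). trace (reduced_matrix W ** X))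
       (\<lambda>(X, z). z \<in> selections E K \<and> reduced_susceptance_laplacian E src tgt b z ** X = mat 1)
       (X, z)"

end

theory Submission
  imports Defs
begin

text \<open>
  By the constraint, the \<open>j\<close>-th column \<open>v\<close> of \<open>X\<close> solves \<open>L v = e\<^sub>j\<close>, where \<open>L\<close> is
  the reduced Laplacian of the selected lines: it lists the node potentials (zero at the
  reference node) when a unit current enters at \<open>j\<close> and leaves at the reference node. The claim
  follows from two facts about these potentials.

  Beyond the critical edge the potential is constant (\<open>unit_current_potential_beyond_cut\<close>).
  The reason is physical: the part of the network behind \<open>j\<close> hangs on the single node \<open>j\<close>, so no
  current flows there. Formally, the deviation of the potential from its value at \<open>j\<close>, restricted
  to \<open>- Vl\<close>, has zero energy.

  The potential at \<open>j\<close> is the weight of a path from \<open>j\<close> to the reference node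
  (\<open>unit_current_potential_eq_path_weight\<close>). Here the budget enters. As \<open>L\<close> is invertible, the
  incidence vectors of the selected lines span the whole \<open>N\<close>-dimensional space; there are at most
  \<open>N\<close> of them, so they are independent, and a current is determined by its nodal injections.
  Invertibility also makes the selected lines connect \<open>j\<close> to the reference node. The unit current
  that \<open>v\<close> drives therefore is the unit current along a path, and the potential drops by
  \<open>1 / b\<^sub>e\<close> across every line \<open>e\<close> of this path. Such a path is also a path in the candidate
  graph, so its weight is at least \<open>h\<^sub>j\<close>.
\<close>

section \<open>Paths and components\<close>

lemma is_path_mono: "is_path S u v p \<Longrightarrow> S \<subseteq> E \<Longrightarrow> is_path E u v p"
  unfolding is_path_def by (auto elim: successively_mono)

lemma reachable_imp_is_path:
  assumes "(u, v) \<in> reachable E"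
  shows "\<exists>p. is_path E u v p"
  using assms unfolding reachable_def
proof (induction rule: converse_rtrancl_induct)
  case base
  have "is_path E v v [v]" by (simp add: is_path_def)
  then show ?case ..
next
  case (step u u')
  then obtain p where p: "is_path E u' v p" by blast
  show ?case
  proof (cases "u \<in> set p")
    case True
    then obtain xs ys where "p = xs @ u # ys" by (meson split_list)
    then have "is_path E u v (u # ys)"
      using p by (auto simp: is_path_def successively_append_iff)
    then show ?thesis ..
  next
    case False
    then have "is_path E u v (u # p)"
      using p step.hyps by (cases p) (auto simp: is_path_def)
    then show ?thesis ..
  qed
qed

lemma shortest_path_weight_le:
  fixes E :: "'v::finite edge set"
  assumes "is_path E u v p"
  shows "shortest_path_weight E x u v \<le> path_weight x p"
proof -
  have "{p. is_path E u v p} \<subseteq> {p. set p \<subseteq> UNIV \<and> length p \<le> CARD('v)}"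
    by (auto simp: is_path_def) (metis card_mono distinct_card finite_class.finite_UNIV top_greatest)
  then have "finite {p. is_path E u v p}"
    using finite_lists_length_le[of "UNIV :: 'v set"] by (metis finite_class.finite_UNIV finite_subset)
  then show ?thesis
    unfolding shortest_path_weight_def using assms by (intro Min_le) auto
qed

lemma path_edges_inj:
  assumes "distinct p"
  shows "inj_on (\<lambda>m. {p ! m, p ! Suc m}) {..<length p - 1}"
proof (rule inj_onI)
  fix m n assume *: "m \<in> {..<length p - 1}" "n \<in> {..<length p - 1}"
    and eq: "{p ! m, p ! Suc m} = {p ! n, p ! Suc n}"
  have "p ! m = p ! n \<and> p ! Suc m = p ! Suc n \<or> p ! m = p ! Suc n \<and> p ! Suc m = p ! n"
    using eq by (auto simp: doubleton_eq_iff)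
  then show "m = n"
    using assms * by (auto simp: nth_eq_iff_index_eq)
qed

lemma component_edge_iff:
  assumes "A \<in> graph_components E" and "{s, t} \<in> E"
  shows "s \<in> A \<longleftrightarrow> t \<in> A"
proof -
  obtain x where A: "A = reachable E `` {x}"
    using assms(1) by (auto simp: graph_components_def elim: quotientE)
  have "(s, t) \<in> {(u, v). {u, v} \<in> E}" "(t, s) \<in> {(u, v). {u, v} \<in> E}"
    using assms(2) by (auto simp: insert_commute)
  then show ?thesis
    unfolding A reachable_def by (auto intro: rtrancl_into_rtrancl)
qed

section \<open>Potentials and currents\<close>

text \<open>
  The reference node is represented by the zero vector, so that \<open>node_vector u \<bullet> y\<close> is the
  potential of any node \<open>u\<close> under the potentials \<open>y\<close>, with the reference node grounded.
\<close>

definition node_vector :: "'n option \<Rightarrow> real^'n::finite" where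
  "node_vector u = (case u of None \<Rightarrow> 0 | Some n \<Rightarrow> axis n 1)"

lemma node_vector_simps [simp]:
  "node_vector None = 0" "node_vector (Some n) = axis n 1"
  by (simp_all add: node_vector_def)

lemma incidence_vector_eq:
  "s \<noteq> t \<Longrightarrow> incidence_vector s t = node_vector s - node_vector t"
  by (cases s; cases t) (auto simp: incidence_vector_def vec_eq_iff axis_def)

lemma independent_family_zero:
  fixes f :: "'a \<Rightarrow> 'b::real_vector"
  assumes "finite S" "independent (f ` S)" "inj_on f S"
    and "(\<Sum>e\<in>S. c e *\<^sub>R f e) = 0" and "e \<in> S"
  shows "c e = 0"
proof -
  let ?g = "\<lambda>x. c (the_inv_into S f x)"
  have "(\<Sum>x\<in>f ` S. ?g x *\<^sub>R x) = (\<Sum>e\<in>S. c e *\<^sub>R f e)"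
    using assms(3) by (simp add: sum.reindex the_inv_into_f_f)
  then have "?g (f e) = 0"
    using assms independentD[of "f ` S" "f ` S" ?g "f e"] by auto
  then show ?thesis
    using assms(3,5) by (simp add: the_inv_into_f_f)
qed

locale oriented_network =
  fixes S :: "'n::finite option edge set"
    and src tgt :: "'n option edge \<Rightarrow> 'n option"
    and b :: "'n option edge \<Rightarrow> real"
  assumes edge_ends: "e \<in> S \<Longrightarrow> {src e, tgt e} = e"
    and ends_distinct: "e \<in> S \<Longrightarrow> src e \<noteq> tgt e"
    and b_pos: "e \<in> S \<Longrightarrow> b e > 0"
begin

abbreviation edge_vector :: "'n option edge \<Rightarrow> real^'n" where
  "edge_vector e \<equiv> incidence_vector (src e) (tgt e)"

definition injection :: "real^'n \<Rightarrow> real^'n" where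
  "injection y = (\<Sum>e\<in>S. (b e * (edge_vector e \<bullet> y)) *\<^sub>R edge_vector e)"

lemma edge_vector_eq: "e \<in> S \<Longrightarrow> edge_vector e = node_vector (src e) - node_vector (tgt e)"
  using ends_distinct by (rule incidence_vector_eq)

lemma inner_injection:
  "x \<bullet> injection y = (\<Sum>e\<in>S. b e * (edge_vector e \<bullet> x) * (edge_vector e \<bullet> y))"
  by (simp add: injection_def inner_sum_right algebra_simps inner_commute)

lemma injection_eq_zeroI: "(\<And>e. e \<in> S \<Longrightarrow> edge_vector e \<bullet> y = 0) \<Longrightarrow> injection y = 0"
  by (simp add: injection_def)

text \<open>
  The energy \<open>y \<bullet> injection y\<close> is a sum of non-negative terms \<open>b\<^sub>e (a\<^sub>e \<bullet> y)\<^sup>2\<close>, so if it vanishes no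
  line carries a current.
\<close>

lemma zero_energy_imp_zero_injection:
  assumes "y \<bullet> injection y = 0"
  shows "injection y = 0"
proof (rule injection_eq_zeroI)
  fix e assume e: "e \<in> S"
  have nonneg: "0 \<le> b e * (edge_vector e \<bullet> y) * (edge_vector e \<bullet> y)" if "e \<in> S" for e
    using b_pos[OF that] by (simp add: mult.assoc)
  have "\<forall>e\<in>S. b e * (edge_vector e \<bullet> y) * (edge_vector e \<bullet> y) = 0"
    using assms nonneg unfolding inner_injection
    by (subst sum_nonneg_eq_0_iff[symmetric]) auto
  then show "edge_vector e \<bullet> y = 0"
    using e b_pos by fastforce
qed

text \<open>
  Potential \<open>0\<close> on the component of the reference node and \<open>1\<close> elsewhere drives no current, so
  under the assumption there is nothing elsewhere.
\<close>

lemma reachable_reference: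
  assumes inj: "\<And>y. injection y = 0 \<Longrightarrow> y = 0"
  shows "(u, None) \<in> reachable S"
proof -
  define y :: "real^'n" where "y = (\<chi> n. if (Some n, None) \<in> reachable S then 0 else 1)"
  have y: "node_vector u \<bullet> y = (if (u, None) \<in> reachable S then 0 else 1)" for u
    by (cases u) (auto simp: y_def inner_axis' reachable_def)
  have "injection y = 0"
  proof (rule injection_eq_zeroI)
    fix e assume e: "e \<in> S"
    then have "{src e, tgt e} \<in> S" "{tgt e, src e} \<in> S"
      using edge_ends by (simp_all add: insert_commute)
    then have "(src e, None) \<in> reachable S \<longleftrightarrow> (tgt e, None) \<in> reachable S"
      unfolding reachable_def by (auto intro: converse_rtrancl_into_rtrancl)
    then show "edge_vector e \<bullet> y = 0"
      using e by (simp add: edge_vector_eq inner_diff_left y)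
  qed
  then have "y = 0" by (rule inj)
  then show ?thesis
    using y[of u] by (auto split: if_splits)
qed

text \<open>
  This is where the budget matters: with more than \<open>N\<close> lines the incidence vectors are dependent,
  and currents could split among several paths.
\<close>

lemma edge_vectors_independent:
  assumes "card S \<le> CARD('n)" and "surj injection"
  shows "independent (edge_vector ` S)" and "inj_on edge_vector S"
proof -
  have "range injection \<subseteq> span (edge_vector ` S)"
    unfolding injection_def by (intro image_subsetI span_sum span_scale span_base imageI)
  then have span: "UNIV \<subseteq> span (edge_vector ` S)"
    by (simp only: assms(2))
  have card_le: "card (edge_vector ` S) \<le> card S"
    by (simp add: card_image_le)
  show indep: "independent (edge_vector ` S)"
    using span card_le assms(1)
    by (intro card_le_dim_spanning[where V = UNIV]) auto
  have "CARD('n) \<le> card (edge_vector ` S)"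
    using span_card_ge_dim[OF _ span] by simp
  then show "inj_on edge_vector S"
    using card_le assms(1) by (intro eq_card_imp_inj_on) auto
qed

lemma unit_current_potential_eq_path_weight:
  assumes indep: "independent (edge_vector ` S)" and inj: "inj_on edge_vector S"
    and v: "injection v = axis j 1" and p: "is_path S (Some j) None p"
  shows "v $ j = path_weight (\<lambda>e. inverse (b e)) p"
proof -
  let ?N = "length p - 1"
  define f where "f m = {p ! m, p ! Suc m}" for m
  \<comment> \<open>\<open>\<sigma> m\<close> records whether the path follows or opposes the orientation of its \<open>m\<close>-th line, and
    \<open>d\<close> is the unit current along the path.\<close>
  define \<sigma> :: "nat \<Rightarrow> real" where "\<sigma> m = (if src (f m) = p ! m then 1 else - 1)" for m
  define d where "d e = (\<Sum>m<?N. if f m = e then \<sigma> m else 0)" for e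
  have p': "p \<noteq> []" "p ! 0 = Some j" "p ! ?N = None" "distinct p"
    using p by (auto simp: is_path_def hd_conv_nth last_conv_nth)
  have f: "f m \<in> S" if "m < ?N" for m
    using p that by (auto simp: is_path_def successively_conv_nth f_def)
  have f_inj: "inj_on f {..<?N}"
    unfolding f_def using p'(4) by (rule path_edges_inj)
  have step: "\<sigma> m *\<^sub>R edge_vector (f m) = node_vector (p ! m) - node_vector (p ! Suc m)"
    if "m < ?N" for m
  proof -
    have "{src (f m), tgt (f m)} = {p ! m, p ! Suc m}"
      using edge_ends[OF f[OF that]] by (simp add: f_def)
    then show ?thesis
      using ends_distinct[OF f[OF that]] edge_vector_eq[OF f[OF that]]
      by (auto simp: \<sigma>_def doubleton_eq_iff)
  qed
  have tele: "(\<Sum>m<?N. node_vector (p ! m) - node_vector (p ! Suc m)) = axis j (1::real)"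
    using sum_lessThan_telescope'[of "\<lambda>m. node_vector (p ! m)" ?N] p' by simp
  have "(\<Sum>e\<in>S. d e *\<^sub>R edge_vector e)
      = (\<Sum>e\<in>S. \<Sum>m<?N. if f m = e then \<sigma> m *\<^sub>R edge_vector e else 0)"
    unfolding d_def scaleR_left.sum by (intro sum.cong refl) auto
  also have "\<dots> = (\<Sum>m<?N. \<Sum>e\<in>S. if f m = e then \<sigma> m *\<^sub>R edge_vector e else 0)"
    by (rule sum.swap)
  also have "\<dots> = (\<Sum>m<?N. \<sigma> m *\<^sub>R edge_vector (f m))"
    using f by (intro sum.cong refl) (simp)
  also have "\<dots> = injection v"
    using tele v by (simp add: step)
  finally have diff: "(\<Sum>e\<in>S. (b e * (edge_vector e \<bullet> v) - d e) *\<^sub>R edge_vector e) = 0"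
    by (simp add: injection_def scaleR_left_diff_distrib sum_subtractf)
  then have current: "b e * (edge_vector e \<bullet> v) = d e" if "e \<in> S" for e
    using independent_family_zero[OF _ indep inj diff that] by simp
  have drop: "node_vector (p ! m) \<bullet> v - node_vector (p ! Suc m) \<bullet> v = inverse (b (f m))"
    if m: "m < ?N" for m
  proof -
    \<comment> \<open>The path does not repeat lines, so only the \<open>m\<close>-th step contributes to \<open>d (f m)\<close>.\<close>
    have "d (f m) = (\<Sum>n<?N. if n = m then \<sigma> m else 0)"
      unfolding d_def using f_inj m by (intro sum.cong refl) (auto dest: inj_onD)
    also have "\<dots> = \<sigma> m" using m by simp
    finally have "b (f m) * (edge_vector (f m) \<bullet> v) = \<sigma> m"
      using current f m by simp
    then have "b (f m) * (\<sigma> m * (edge_vector (f m) \<bullet> v)) = \<sigma> m * \<sigma> m"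
      by (simp add: algebra_simps)
    moreover have "\<sigma> m * \<sigma> m = 1" by (simp add: \<sigma>_def)
    moreover have "\<sigma> m * (edge_vector (f m) \<bullet> v)
        = node_vector (p ! m) \<bullet> v - node_vector (p ! Suc m) \<bullet> v"
      using arg_cong[OF step[OF m], of "\<lambda>x. x \<bullet> v"] by (simp add: inner_diff_left)
    ultimately show ?thesis
      by (metis inverse_unique)
  qed
  have "v $ j = (\<Sum>m<?N. node_vector (p ! m) - node_vector (p ! Suc m)) \<bullet> v"
    unfolding tele by (simp add: inner_axis')
  also have "\<dots> = path_weight (\<lambda>e. inverse (b e)) p"
    by (simp add: inner_sum_left inner_diff_left drop path_weight_def f_def)
  finally show ?thesis .
qed

text \<open>
  Let \<open>y\<close> be the deviation \<open>v - v\<^sub>j\<close> on \<open>C\<close>, and zero outside \<open>C\<close>. Across every line the drop of \<open>y\<close> is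
  either that of \<open>v\<close> or zero: on the only line that enters \<open>C\<close> both end points have deviation
  zero. So the energy of \<open>y\<close> equals \<open>y \<bullet> injection v\<close>, which is \<open>y\<^sub>j = 0\<close>.
\<close>

lemma unit_current_potential_beyond_cut:
  assumes inj: "\<And>y. injection y = 0 \<Longrightarrow> y = 0"
    and v: "injection v = axis j 1"
    and C: "None \<notin> C" "i \<notin> C"
    and cut: "\<And>s t. {s, t} \<in> S \<Longrightarrow> {s, t} \<noteq> {i, Some j} \<Longrightarrow> s \<in> C \<longleftrightarrow> t \<in> C"
    and k: "Some k \<in> C"
  shows "v $ k = v $ j"
proof -
  define y :: "real^'n" where "y = (\<chi> n. if Some n \<in> C then v $ n - v $ j else 0)"
  have y: "node_vector u \<bullet> y = (if u \<in> C then node_vector u \<bullet> v - v $ j else 0)" for u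
    using C(1) by (cases u) (auto simp: y_def inner_axis')
  have drop: "(edge_vector e \<bullet> y) * (edge_vector e \<bullet> y) = (edge_vector e \<bullet> y) * (edge_vector e \<bullet> v)"
    if e: "e \<in> S" for e
  proof (cases "e = {i, Some j}")
    case True
    then have "{src e, tgt e} = {i, Some j}" using edge_ends[OF e] by simp
    then have "edge_vector e \<bullet> y = 0"
      using C(2) by (auto simp: edge_vector_eq[OF e] inner_diff_left y doubleton_eq_iff inner_axis')
    then show ?thesis by simp
  next
    case False
    then have "src e \<in> C \<longleftrightarrow> tgt e \<in> C"
      using cut[of "src e" "tgt e"] e edge_ends[OF e] by simp
    then show ?thesis
      by (auto simp: edge_vector_eq[OF e] inner_diff_left y)
  qed
  have "y \<bullet> injection y = y \<bullet> injection v"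
    unfolding inner_injection by (intro sum.cong refl) (simp add: mult.assoc drop)
  also have "\<dots> = 0"
    by (simp add: v inner_axis y_def)
  finally have "y = 0"
    using inj zero_energy_imp_zero_injection by blast
  then have "y $ k = 0" by simp
  then show ?thesis using k by (simp add: y_def)
qed

end

section \<open>The bound for radial networks\<close>

lemma outer_product_mult_vector:
  fixes a y :: "real^'n"
  shows "(columnvector a ** (rowvector a :: real^'n^1)) *v y = (a \<bullet> y) *\<^sub>R a"
  by (simp add: vec_eq_iff matrix_vector_mult_def matrix_matrix_mult_def columnvector_def
      rowvector_def inner_vec_def sum_distrib_left sum_distrib_right mult_ac)

lemma sum_matrix_vector_mult:
  fixes A :: "'a \<Rightarrow> real^'n^'m"
  shows "(\<Sum>e\<in>E. A e) *v y = (\<Sum>e\<in>E. A e *v y)"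
  by (induction E rule: infinite_finite_induct) (simp_all add: matrix_vector_mult_add_rdistrib)

lemma reduced_susceptance_laplacian_mult_vector:
  assumes "oriented_network {e \<in> E. z e = 1} src tgt b" and "z \<in> E \<rightarrow> {0, 1}"
  shows "reduced_susceptance_laplacian E src tgt b z *v y
    = oriented_network.injection {e \<in> E. z e = 1} src tgt b y"
proof -
  have "reduced_susceptance_laplacian E src tgt b z *v y = (\<Sum>e\<in>E. (z e * b e) *\<^sub>R
      ((incidence_vector (src e) (tgt e) \<bullet> y) *\<^sub>R incidence_vector (src e) (tgt e)))"
    by (simp add: reduced_susceptance_laplacian_def Let_def sum_matrix_vector_mult
        scaleR_matrix_vector_assoc[symmetric] outer_product_mult_vector)
  also have "\<dots> = (\<Sum>e\<in>E. if z e = 1 then (b e * (incidence_vector (src e) (tgt e) \<bullet> y)) *\<^sub>R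
      incidence_vector (src e) (tgt e) else 0)"
    using assms(2) by (intro sum.cong refl) (auto dest!: funcset_mem)
  also have "\<dots> = oriented_network.injection {e \<in> E. z e = 1} src tgt b y"
    unfolding oriented_network.injection_def[OF assms(1)]
    by (simp add: sum.inter_filter)
  finally show ?thesis .
qed

lemma card_selected:
  fixes E :: "'n::finite option edge set"
  assumes "z \<in> selections E K"
  shows "card {e \<in> E. z e = 1} \<le> K"
proof -
  have "real (card {e \<in> E. z e = 1}) = (\<Sum>e\<in>E. if z e = 1 then 1 else 0)"
    by (simp add: sum.If_cases Collect_conj_eq)
  also have "\<dots> = (\<Sum>e\<in>E. z e)"
    using assms by (intro sum.cong refl) (auto simp: selections_def dest!: PiE_mem)
  also have "\<dots> \<le> real K"
    using assms by (simp add: selections_def)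
  finally show ?thesis by simp
qed

theorem lemma4:
  fixes E F :: "'n::finite option edge set"
    and src tgt :: "'n option edge \<Rightarrow> 'n option"
    and b w z :: "'n option edge \<Rightarrow> real"
    and W :: "real^('n option)^('n option)"
    and X :: "real^'n^'n"
    and l :: "'n option edge" and i :: "'n option" and j :: 'n
    and Vl :: "'n option set"
  assumes "simple_graph E"
    and "\<forall>e\<in>E. e = {src e, tgt e}"
    and "\<forall>e\<in>E. b e > 0"
    and "simple_graph F" and "connected_graph F" and "\<forall>e\<in>F. w e \<ge> 0"
    and "W = laplacian F w"
    and "design_minimizer E src tgt b W CARD('n) X z"
    and "critical_edge E l" and "l = {i, Some j}"
    and "graph_components (E - {l}) = {Vl, - Vl}"
    and "i \<in> Vl" and "None \<in> Vl"
  shows "\<forall>k. Some k \<in> - Vl \<longrightarrow>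
           shortest_path_weight E (\<lambda>e. inverse (b e)) (Some j) None \<le> X $ k $ j"
proof (intro allI impI)
  fix k assume k: "Some k \<in> - Vl"
  let ?L = "reduced_susceptance_laplacian E src tgt b z"
  define S where "S = {e \<in> E. z e = 1}"
  have z: "z \<in> selections E CARD('n)" and LX: "?L ** X = mat 1"
    using assms(8) by (auto simp: design_minimizer_def is_arg_min_def)
  then have XL: "X ** ?L = mat 1"
    by (simp add: matrix_left_right_inverse)
  interpret oriented_network S src tgt b
  proof
    fix e assume "e \<in> S"
    then have e: "e \<in> E" by (simp add: S_def)
    show ends: "{src e, tgt e} = e" using assms(2) e by blast
    have "card e = 2" using assms(1) e by (simp add: simple_graph_def)
    then show "src e \<noteq> tgt e" using ends by (metis card_2_iff doubleton_eq_iff)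
    show "b e > 0" using assms(3) e by blast
  qed
  have inj_eq: "?L *v y = injection y" for y
    using reduced_susceptance_laplacian_mult_vector[of E z src tgt b y] z oriented_network_axioms
    unfolding S_def selections_def by (auto simp: PiE_def)
  have injective: "y = 0" if "injection y = 0" for y
  proof -
    have "y = (X ** ?L) *v y" by (simp add: XL)
    also have "\<dots> = X *v injection y"
      by (simp only: matrix_vector_mul_assoc[symmetric] inj_eq)
    finally show ?thesis using that by simp
  qed
  have right_inverse: "injection (X *v y) = y" for y
    by (simp add: inj_eq[symmetric] matrix_vector_mul_assoc LX)
  then have surj: "surj injection" by (rule surjI)
  define v where "v = X *v axis j 1"
  have v: "injection v = axis j 1" by (simp add: v_def right_inverse)
  have v_eq: "v $ n = X $ n $ j" for n
    by (simp add: v_def matrix_vector_mult_basis column_def)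

  have "card S \<le> CARD('n)" unfolding S_def using z by (rule card_selected)
  note indep = edge_vectors_independent[OF this surj]
  obtain p where p: "is_path S (Some j) None p"
    using reachable_imp_is_path[OF reachable_reference[OF injective]] by blast
  then have "is_path E (Some j) None p"
    by (rule is_path_mono) (auto simp: S_def)
  then have "shortest_path_weight E (\<lambda>e. inverse (b e)) (Some j) None
      \<le> path_weight (\<lambda>e. inverse (b e)) p"
    by (rule shortest_path_weight_le)
  also have "\<dots> = v $ j"
    using unit_current_potential_eq_path_weight[OF indep v p] by simp
  also have "\<dots> = v $ k"
  proof (rule unit_current_potential_beyond_cut[OF injective v, symmetric])
    show "None \<notin> - Vl" "i \<notin> - Vl" using assms(12,13) by auto
    show "Some k \<in> - Vl" by (fact k)
    show "s \<in> - Vl \<longleftrightarrow> t \<in> - Vl" if "{s, t} \<in> S" "{s, t} \<noteq> {i, Some j}" for s t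
      using component_edge_iff[of "- Vl" "E - {l}" s t] that assms(10,11) by (auto simp: S_def)
  qed
  also have "\<dots> = X $ k $ j" by (rule v_eq)
  finally show "shortest_path_weight E (\<lambda>e. inverse (b e)) (Some j) None \<le> X $ k $ j" .
qed

end
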